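(* Let $d\ge3$ and let $X=\{x_1,\ldots,x_N\}\subset\mathbb S^{d-1}$ be a spherical $t$-design, $t\ge2$. If its Steiner-normalized Minkowski polytope $P_X$ is simple and self-polar up to scale, then $P_X$ is a $d$-simplex, $N=d+1$, and $X$ is (the vertex set of) a regular simplex. In particular, the design strength is at most two, i.e. $X$ is not a spherical $3$-design.
   Context: $\sigma$ is the normalized (probability) surface measure on the unit sphere $\mathbb S^{d-1}\subset\mathbb R^d$, and $\omega_{d-1}$ is the total $(d-1)$-area of $\mathbb S^{d-1}$. A finite set $X=\{x_1,\ldots,x_N\}\subset\mathbb S^{d-1}$ of $N$ distinct points is a spherical $t$-design if $\frac1N\sum_i p(x_i)=\int p\,d\sigma$ for every polynomial $p$ of total degree at most $t$. For $t\ge2$, the Minkowski polytope $P_X\subset\mathbb R^d$ is the full-dimensional convex polytope, unique up to translation, whose surface area measure is $\frac{\omega_{d-1}}N\sum_i\delta_{x_i}$: it has exactly $N$ facets, with outer unit normals $x_1,\ldots,x_N$, each of $(d-1)$-area $\omega_{d-1}/N$. It is Steiner-normalized: the translate is chosen so that the Steiner point $d\int_{\mathbb S^{d-1}}h_{P_X}(u)u\,d\sigma(u)$ is $0$ (with $h_P(u)=\max_{y\in P}\langle u,y\rangle$), which implies $0\in\operatorname{int}P_X$. The polar is $P^\circ=\{z:\langle z,y\rangle\le1\ \forall y\in P\}$, and $P$ is self-polar up to scale if $P^\circ=cUP$ for some $c>0$ and $U\in O(d)$. A $d$-polytope is simple if every vertex lies in exactly $d$ facets. *)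

theory Defs
  imports "HOL-Analysis.Analysis"
begin

text \<open>
  The (unnormalized) surface measure of a Borel set \<open>A\<close> of the unit sphere of \<open>\<real>\<^sup>d\<close>
  is \<open>d\<close> times the Lebesgue measure of the cone \<open>{r *\<^sub>R u | 0 < r < 1, u \<in> A}\<close>
  (polar coordinates); \<open>sgn x = x /\<^sub>R norm x\<close> is the radial projection.
  It is a measure on the Borel sets of the whole space, concentrated on \<open>sphere 0 1\<close>.
\<close>

definition sphere_area_measure :: "(real ^ 'n) measure" where
  "sphere_area_measure =
     scale_measure (of_nat CARD('n)) (distr (restrict_space lborel (ball 0 1 - {0})) borel sgn)"

definition sphere_area :: "'n::finite itself \<Rightarrow> real" where
  "sphere_area _ = measure (sphere_area_measure :: (real ^ 'n) measure) (sphere 0 1)"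

definition sphere_sigma :: "(real ^ 'n) measure" where
  "sphere_sigma = uniform_measure sphere_area_measure (sphere 0 1)"

definition monomial_fun :: "('n \<Rightarrow> nat) \<Rightarrow> real ^ 'n \<Rightarrow> real" where
  "monomial_fun \<alpha> x = (\<Prod>i\<in>UNIV. (x $ i) ^ \<alpha> i)"

definition polynomial_deg_le :: "nat \<Rightarrow> (real ^ 'n \<Rightarrow> real) \<Rightarrow> bool" where
  "polynomial_deg_le t p \<longleftrightarrow>
     (\<exists>c. p = (\<lambda>x. \<Sum>\<alpha> | (\<Sum>i\<in>UNIV. \<alpha> i) \<le> t. c \<alpha> * monomial_fun \<alpha> x))"

text \<open>Finiteness of the index set of the sum in \<open>polynomial_deg_le\<close> (a sum over an infinite set would be 0).\<close>

lemma finite_multi_indices: "finite {\<alpha> :: 'n::finite \<Rightarrow> nat. (\<Sum>i\<in>UNIV. \<alpha> i) \<le> t}"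
proof (rule finite_subset)
  show "{\<alpha> :: 'n \<Rightarrow> nat. (\<Sum>i\<in>UNIV. \<alpha> i) \<le> t} \<subseteq> (UNIV \<rightarrow>\<^sub>E {..t})"
  proof
    fix \<alpha> :: "'n \<Rightarrow> nat" assume "\<alpha> \<in> {\<alpha>. (\<Sum>i\<in>UNIV. \<alpha> i) \<le> t}"
    then have "\<alpha> i \<le> t" for i
      using member_le_sum[of i UNIV \<alpha>] by simp
    then show "\<alpha> \<in> (UNIV \<rightarrow>\<^sub>E {..t})" by (auto simp: PiE_def extensional_def)
  qed
  show "finite ((UNIV :: 'n set) \<rightarrow>\<^sub>E {..t})"
    by (rule finite_PiE) auto
qed

definition spherical_design :: "nat \<Rightarrow> (real ^ 'n) set \<Rightarrow> bool" where
  "spherical_design t X \<longleftrightarrow>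
     finite X \<and> X \<subseteq> sphere 0 1 \<and>
     (\<forall>p. polynomial_deg_le t p \<longrightarrow>
        (\<Sum>x\<in>X. p x) / real (card X) = (LINT u|sphere_sigma. p u))"

definition support_fun :: "(real ^ 'n) set \<Rightarrow> real ^ 'n \<Rightarrow> real" where
  "support_fun P u = (SUP y\<in>P. u \<bullet> y)"

definition support_face :: "(real ^ 'n) set \<Rightarrow> real ^ 'n \<Rightarrow> (real ^ 'n) set" where
  "support_face P u = {y \<in> P. u \<bullet> y = support_fun P u}"

text \<open>
  For a set \<open>F\<close> in a hyperplane with unit normal \<open>u\<close>, its \<open>(d-1)\<close>-dimensional Lebesgue
  measure is, by Fubini, the \<open>d\<close>-dimensional one of the right prism of height 1 over \<open>F\<close>.
\<close>

definition hyperplane_area :: "real ^ 'n \<Rightarrow> (real ^ 'n) set \<Rightarrow> real" where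
  "hyperplane_area u F = measure lebesgue {y + s *\<^sub>R u | y s. y \<in> F \<and> s \<in> {0..1}}"

text \<open>
  The surface area measure of \<open>P\<close> is \<open>\<omega>/N\<close> times the sum of the point masses at the
  points of \<open>X\<close>: sending \<open>x\<close> to the face with outer normal \<open>x\<close> is a bijection from
  \<open>X\<close> to the facets, all of which have area \<open>\<omega>/N\<close>. This determines \<open>P\<close> only up to
  translation.
\<close>

definition minkowski_polytope :: "(real ^ 'n) set \<Rightarrow> (real ^ 'n) set \<Rightarrow> bool" where
  "minkowski_polytope X P \<longleftrightarrow>
     polytope P \<and> interior P \<noteq> {} \<and>
     bij_betw (support_face P) X {F. F facet_of P} \<and>
     (\<forall>x\<in>X. hyperplane_area x (support_face P x) = sphere_area TYPE('n) / real (card X))"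

definition steiner_point :: "(real ^ 'n) set \<Rightarrow> real ^ 'n" where
  "steiner_point P = real CARD('n) *\<^sub>R (LINT u|sphere_sigma. support_fun P u *\<^sub>R u)"

definition polar :: "(real ^ 'n) set \<Rightarrow> (real ^ 'n) set" where
  "polar P = {z. \<forall>y\<in>P. z \<bullet> y \<le> 1}"

definition self_polar_up_to_scale :: "(real ^ 'n) set \<Rightarrow> bool" where
  "self_polar_up_to_scale P \<longleftrightarrow>
     (\<exists>c U. c > 0 \<and> orthogonal_transformation U \<and> polar P = (\<lambda>y. c *\<^sub>R U y) ` P)"

definition simple_polytope :: "(real ^ 'n) set \<Rightarrow> bool" where
  "simple_polytope P \<longleftrightarrow>
     polytope P \<and>
     (\<forall>v. v extreme_point_of P \<longrightarrow> int (card {F. F facet_of P \<and> v \<in> F}) = aff_dim P)"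

definition regular_simplex_vertices :: "(real ^ 'n) set \<Rightarrow> bool" where
  "regular_simplex_vertices V \<longleftrightarrow>
     finite V \<and> \<not> affine_dependent V \<and>
     (\<exists>l. \<forall>x\<in>V. \<forall>y\<in>V. x \<noteq> y \<longrightarrow> dist x y = l)"

end

theory Submission
  imports Defs
begin

text \<open>
  The polar of \<open>P\<close> has a vertex for each facet of \<open>P\<close>, so a simple self-polar polytope is also
  simplicial, and for \<open>d \<ge> 3\<close> a simple and simplicial polytope is a simplex. Hence \<open>N = d + 1\<close>.
  For a 2-design the second moments give the tight frame identity
  \<open>\<Sum>\<^sub>x (a \<bullet> x) x = (N/d) a\<close>, which for \<open>N = d + 1\<close> forces \<open>x \<bullet> y = -1/d\<close> for
  distinct points; then \<open>\<Sum>\<^sub>y (x \<bullet> y)\<^sup>3 = 1 - 1/d\<^sup>2 \<noteq> 0\<close> excludes 3-designs.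
\<close>

subsection \<open>Simple self-polar polytopes\<close>

text \<open>Self-polarity gives a linear bijection \<open>h\<close> from \<open>P\<close> onto its
  polar, so the images of the vertices serve twice: as inequalities that cut out \<open>P\<close>
  and as vertices of the polar. Simplicity bounds the number of inequalities tight at a vertex. The
  dual bound, on the vertices of a facet, comes from the adjoint of \<open>h\<close>, which also
  carries \<open>P\<close> onto the polar. Dimension three enters because every polygon is both
  simple and simplicial: relating two neighbours of a vertex takes a third facet through it. No
  integral over the sphere is computed. Sign changes and transpositions of coordinates preserve
  Lebesgue measure, hence \<open>sphere_sigma\<close>; they make odd and mixed second moments vanish
  and the squares equal, and unit length fixes the common value.\<close>

text \<open>Slack inequalities stay slack for small \<open>e\<close> by continuity, tight ones do
  not grow along \<open>u\<close>, and finitely many right neighbourhoods of 0 have a common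
  point.\<close>

lemma perturb_tight_inequalities:
  fixes v u :: "'a :: euclidean_space"
  assumes "finite W" and valid: "\<And>w. w \<in> W \<Longrightarrow> w \<bullet> v \<le> 1"
    and tight: "\<And>w. w \<in> W \<Longrightarrow> w \<bullet> v = 1 \<Longrightarrow> w \<bullet> u \<le> 0"
  obtains e where "e > 0" "\<And>w. w \<in> W \<Longrightarrow> w \<bullet> (v + e *\<^sub>R u) \<le> 1"
proof -
  have "\<forall>\<^sub>F e in at_right 0. w \<bullet> (v + e *\<^sub>R u) \<le> 1" if w: "w \<in> W" for w
  proof (cases "w \<bullet> v = 1")
    case True
    have "\<forall>\<^sub>F e in at_right 0. e > (0::real)" by (rule eventually_at_right_less)
    then show ?thesis
      by eventually_elim (use True tight[OF w True] in \<open>simp add: inner_add_right mult_nonneg_nonpos\<close>)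
  next
    case False
    then have "w \<bullet> (v + 0 *\<^sub>R u) < 1" using valid[OF w] by simp
    moreover have "((\<lambda>e. w \<bullet> (v + e *\<^sub>R u)) \<longlongrightarrow> w \<bullet> (v + 0 *\<^sub>R u)) (at_right 0)"
      by (intro tendsto_intros)
    ultimately have "\<forall>\<^sub>F e in at_right 0. w \<bullet> (v + e *\<^sub>R u) < 1"
      by (rule order_tendstoD(2)[rotated])
    then show ?thesis by eventually_elim simp
  qed
  then have "\<forall>\<^sub>F e in at_right 0. \<forall>w\<in>W. w \<bullet> (v + e *\<^sub>R u) \<le> 1"
    using \<open>finite W\<close> by (simp add: eventually_ball_finite)
  moreover have "\<forall>\<^sub>F e in at_right 0. e > (0::real)" by (rule eventually_at_right_less)
  ultimately have "\<forall>\<^sub>F e in at_right 0. e > 0 \<and> (\<forall>w\<in>W. w \<bullet> (v + e *\<^sub>R u) \<le> 1)"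
    by eventually_elim simp
  then obtain e where "e > 0 \<and> (\<forall>w\<in>W. w \<bullet> (v + e *\<^sub>R u) \<le> 1)"
    using eventually_happens'[OF trivial_limit_at_right_real] by blast
  then show ?thesis using that by blast
qed

text \<open>A direction orthogonal to the tight normals can be followed from \<open>v\<close> both
  ways without leaving \<open>P\<close>, so a nonzero one would put \<open>v\<close> inside a
  segment of \<open>P\<close>.\<close>

lemma extreme_point_tight_orthogonal:
  fixes v u :: "'a :: euclidean_space"
  assumes W: "finite W" and P: "P = {y. \<forall>w\<in>W. w \<bullet> y \<le> 1}"
    and v: "v extreme_point_of P" and u: "\<And>w. w \<in> W \<Longrightarrow> w \<bullet> v = 1 \<Longrightarrow> w \<bullet> u = 0"
  shows "u = 0"
proof (rule ccontr)
  assume "u \<noteq> 0"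
  have v_in: "w \<bullet> v \<le> 1" if "w \<in> W" for w
    using v that by (auto simp: extreme_point_of_def P)
  obtain e where e: "e > 0" "\<And>w. w \<in> W \<Longrightarrow> w \<bullet> (v + e *\<^sub>R u) \<le> 1"
    using perturb_tight_inequalities[OF W v_in, of u] u by auto
  obtain e' where e': "e' > 0" "\<And>w. w \<in> W \<Longrightarrow> w \<bullet> (v + e' *\<^sub>R (- u)) \<le> 1"
    using perturb_tight_inequalities[OF W v_in, of "- u"] u by auto
  have "v + e *\<^sub>R u \<in> P" "v + e' *\<^sub>R (- u) \<in> P"
    using e e' by (auto simp: P)
  moreover have "v \<in> open_segment (v + e *\<^sub>R u) (v + e' *\<^sub>R (- u))"
  proof -
    have "v + e *\<^sub>R u \<noteq> v + e' *\<^sub>R (- u)"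
    proof
      assume "v + e *\<^sub>R u = v + e' *\<^sub>R (- u)"
      then have "(e + e') *\<^sub>R u = 0" by (simp add: algebra_simps)
      then show False using \<open>u \<noteq> 0\<close> e(1) e'(1) by simp
    qed
    \<comment> \<open>The two displacements may differ in length; \<open>e / (e + e')\<close> is the
      weight that cancels them.\<close>
    moreover have "v = (1 - e / (e + e')) *\<^sub>R (v + e *\<^sub>R u) + (e / (e + e')) *\<^sub>R (v + e' *\<^sub>R (- u))"
    proof -
      have "(1 - e / (e + e')) * e - e / (e + e') * e' = 0"
        using e(1) e'(1) by (simp add: field_simps)
      moreover have "(1 - l) *\<^sub>R (v + e *\<^sub>R u) + l *\<^sub>R (v + e' *\<^sub>R (- u)) = v + ((1 - l) * e - l * e') *\<^sub>R u" for l
        by (simp add: algebra_simps)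
      ultimately show ?thesis by simp
    qed
    ultimately show ?thesis
      unfolding in_segment using e(1) e'(1) by (intro conjI exI[of _ "e / (e + e')"]) auto
  qed
  ultimately show False using v unfolding extreme_point_of_def by blast
qed

lemma extreme_point_tight_span:
  fixes v :: "'a :: euclidean_space"
  assumes "finite W" and "P = {y. \<forall>w\<in>W. w \<bullet> y \<le> 1}" and "v extreme_point_of P"
  shows "span {w\<in>W. w \<bullet> v = 1} = UNIV"
proof (rule ccontr)
  assume "span {w\<in>W. w \<bullet> v = 1} \<noteq> UNIV"
  then obtain u where "u \<noteq> 0" "\<And>w. w \<in> span {w\<in>W. w \<bullet> v = 1} \<Longrightarrow> u \<bullet> w = 0"
    using span_not_univ_subset_hyperplane by blast
  then show False
    using extreme_point_tight_orthogonal[OF assms, of u] by (auto simp: span_base inner_commute)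
qed

text \<open>At a simple vertex one facet can be left along an edge that stays in all the others;
  the vertices of \<open>P\<close> needed to represent a point of this edge contain its other end.\<close>

lemma simple_vertex_neighbour:
  fixes v w :: "'a :: euclidean_space"
  assumes W: "finite W" and P: "P = {y. \<forall>w\<in>W. w \<bullet> y \<le> 1}"
    and V: "finite V" "P = convex hull V"
    and v: "v extreme_point_of P" and simple: "card {w\<in>W. w \<bullet> v = 1} \<le> DIM('a)"
    and w: "w \<in> W" "w \<bullet> v = 1"
  obtains p where "p \<in> V" "w \<bullet> p \<noteq> 1" "\<And>w'. w' \<in> W \<Longrightarrow> w' \<bullet> v = 1 \<Longrightarrow> w' \<noteq> w \<Longrightarrow> w' \<bullet> p = 1"
proof -
  let ?R = "{w\<in>W. w \<bullet> v = 1} - {w}"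
  have "dim ?R \<le> card ?R"
    using W by (intro dim_le_card') auto
  also have "\<dots> < card {w\<in>W. w \<bullet> v = 1}"
    using W w by (intro psubset_card_mono) auto
  finally have "dim ?R < DIM('a)" using simple by simp
  \<comment> \<open>\<open>a\<close> is the direction of the edge: every tight inequality except
    that of \<open>w\<close> stays tight along it.\<close>
  then obtain a where a0: "a \<noteq> 0" and orth: "\<And>w'. w' \<in> span ?R \<Longrightarrow> orthogonal a w'"
    using orthogonal_to_subspace_exists[of ?R] by metis
  have a: "w' \<bullet> a = 0" if "w' \<in> ?R" for w'
    using orth[OF span_base[OF that]] by (simp add: orthogonal_def inner_commute)
  have "w \<bullet> a \<noteq> 0"
  proof
    assume "w \<bullet> a = 0"
    then have "w' \<bullet> a = 0" if "w' \<in> W" "w' \<bullet> v = 1" for w'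
      using a[of w'] that by (cases "w' = w") auto
    then show False using extreme_point_tight_orthogonal[OF W P v, of a] a0 by blast
  qed
  \<comment> \<open>This factor settles the sign: \<open>w \<bullet> u\<close> is minus the square
    of \<open>w \<bullet> a\<close>.\<close>
  define u where "u = - (w \<bullet> a) *\<^sub>R a"
  have u: "w \<bullet> u < 0" "\<And>w'. w' \<in> ?R \<Longrightarrow> w' \<bullet> u = 0"
    using a \<open>w \<bullet> a \<noteq> 0\<close> by (simp_all add: u_def flip: power2_eq_square)
  have v_in: "w' \<bullet> v \<le> 1" if "w' \<in> W" for w'
    using v that by (auto simp: extreme_point_of_def P)
  have "w' \<bullet> u \<le> 0" if "w' \<in> W" "w' \<bullet> v = 1" for w'
    using u that by (cases "w' = w") auto
  then obtain e where e: "e > 0" "\<And>w'. w' \<in> W \<Longrightarrow> w' \<bullet> (v + e *\<^sub>R u) \<le> 1"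
    using perturb_tight_inequalities[OF W v_in, of u] by metis
  then have "v + e *\<^sub>R u \<in> convex hull V"
    using P V by auto
  then obtain c where c: "\<And>p. p \<in> V \<Longrightarrow> 0 \<le> c p" "sum c V = 1" "(\<Sum>p\<in>V. c p *\<^sub>R p) = v + e *\<^sub>R u"
    using V(1) by (auto simp: convex_hull_finite)
  have V_in: "w' \<bullet> p \<le> 1" if "w' \<in> W" "p \<in> V" for w' p
    using that hull_inc[of p V convex] V(2) P by auto
  \<comment> \<open>Slack is affine, so the slack on the edge is the weighted mean of the slacks at
    the vertices. For members of \<open>W\<close> all terms are nonnegative: zero slack passes to
    every vertex of positive weight, while the positive slack of \<open>w\<close> yields such a
    vertex off \<open>w\<close>.\<close>
  have defect: "(\<Sum>p\<in>V. c p * (1 - w' \<bullet> p)) = 1 - w' \<bullet> (v + e *\<^sub>R u)" for w'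
    unfolding c(3)[symmetric] by (simp add: inner_sum_right right_diff_distrib sum_subtractf c(2))
  have "\<not> (\<forall>p\<in>V. c p * (1 - w \<bullet> p) = 0)"
  proof
    assume "\<forall>p\<in>V. c p * (1 - w \<bullet> p) = 0"
    then have "(\<Sum>p\<in>V. c p * (1 - w \<bullet> p)) = 0" by (rule sum.neutral)
    then have "1 - w \<bullet> (v + e *\<^sub>R u) = 0" by (simp only: defect)
    then show False using u(1) e(1) w(2) by (simp add: inner_add_right)
  qed
  then obtain p where p: "p \<in> V" "c p \<noteq> 0" "w \<bullet> p \<noteq> 1" by auto
  have "w' \<bullet> p = 1" if w': "w' \<in> W" "w' \<bullet> v = 1" "w' \<noteq> w" for w'
  proof -
    have "(\<Sum>p\<in>V. c p * (1 - w' \<bullet> p)) = 0"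
      using defect[of w'] u(2)[of w'] w' by (simp add: inner_add_right)
    then have "c p * (1 - w' \<bullet> p) = 0"
      using V(1) p(1) c(1) V_in[OF w'(1)] by (subst (asm) sum_nonneg_eq_0_iff) auto
    then show ?thesis using p(2) by simp
  qed
  then show ?thesis using that p by blast
qed

section \<open>Recognizing a simplex and counting its facets\<close>

text \<open>The inequality \<open>f s\<close> is tight at all points of \<open>S\<close> but
  \<open>s\<close>, so its slack at an affine combination is the coefficient of \<open>s\<close>
  times a positive constant. Slacks thus detect affine relations, and their nonnegativity on
  \<open>P\<close> makes the barycentric coordinates nonnegative there.\<close>

lemma simplex_of_opposite_inequalities:
  fixes S :: "'a :: euclidean_space set"
  assumes card: "card S = DIM('a) + 1" and SP: "convex hull S \<subseteq> P"
    and f1: "\<And>s s'. s \<in> S \<Longrightarrow> s' \<in> S \<Longrightarrow> s' \<noteq> s \<Longrightarrow> f s \<bullet> s' = 1"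
    and f2: "\<And>s. s \<in> S \<Longrightarrow> f s \<bullet> s < 1"
    and f3: "\<And>s y. s \<in> S \<Longrightarrow> y \<in> P \<Longrightarrow> f s \<bullet> y \<le> 1"
  shows "\<not> affine_dependent S \<and> P = convex hull S"
proof -
  have fin: "finite S" using card by (metis add_is_0 card.infinite one_neq_zero)
  have coord: "(\<Sum>s'\<in>S. l s') - f s \<bullet> (\<Sum>s'\<in>S. l s' *\<^sub>R s') = l s * (1 - f s \<bullet> s)"
    if s: "s \<in> S" for s and l :: "'a \<Rightarrow> real"
  proof -
    have "(\<Sum>s'\<in>S. l s') - f s \<bullet> (\<Sum>s'\<in>S. l s' *\<^sub>R s') = (\<Sum>s'\<in>S. l s' * (1 - f s \<bullet> s'))"
      by (simp add: inner_sum_right right_diff_distrib sum_subtractf)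
    also have "\<dots> = l s * (1 - f s \<bullet> s) + (\<Sum>s'\<in>S - {s}. l s' * (1 - f s \<bullet> s'))"
      by (rule sum.remove[OF fin s])
    also have "(\<Sum>s'\<in>S - {s}. l s' * (1 - f s \<bullet> s')) = 0"
      using f1[OF s] by (intro sum.neutral) auto
    finally show ?thesis by simp
  qed
  have indep: "\<not> affine_dependent S"
  proof
    assume "affine_dependent S"
    then obtain l s where l: "sum l S = 0" "(\<Sum>z\<in>S. l z *\<^sub>R z) = 0" and s: "s \<in> S" "l s \<noteq> 0"
      using affine_dependent_explicit_finite[OF fin] by auto
    then show False using coord[OF s(1), of l] f2[OF s(1)] by simp
  qed
  have "aff_dim S = DIM('a)"
    using aff_dim_affine_independent[OF indep] card by simp
  then have hull: "affine hull S = UNIV"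
    using aff_dim_eq_full by blast
  have "y \<in> convex hull S" if y: "y \<in> P" for y
  proof -
    obtain l where l: "sum l S = 1" "(\<Sum>s\<in>S. l s *\<^sub>R s) = y"
      using hull affine_hull_finite[OF fin] by blast
    have "l s \<ge> 0" if s: "s \<in> S" for s
      using coord[OF s, of l] l f3[OF s y] f2[OF s]
      by (metis diff_ge_0_iff_ge diff_gt_0_iff_gt zero_le_mult_iff not_less)
    then show ?thesis
      using l by (auto simp: convex_hull_finite[OF fin])
  qed
  then show ?thesis using indep SP by auto
qed

text \<open>Let \<open>v\<close> be a vertex and \<open>N w\<close> its neighbour outside the facet \<open>w\<close>. As a facet has only \<open>d\<close>
  vertices, \<open>w\<close> contains nothing but \<open>v\<close> and the other \<open>d - 1\<close> neighbours. The neighbour \<open>N w0\<close> lies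
  on one facet \<open>g\<close> that does not contain \<open>v\<close>. Leaving \<open>w \<noteq> w0\<close> from \<open>N w0\<close> leads, inside a third
  facet, to \<open>N w\<close>, so that \<open>g\<close> contains all the neighbours.\<close>

lemma simple_simplicial_simplex:
  fixes P :: "'a :: euclidean_space set"
  assumes W: "finite W" and P: "P = {y. \<forall>w\<in>W. w \<bullet> y \<le> 1}"
    and V: "finite V" "P = convex hull V" "\<And>v. v \<in> V \<Longrightarrow> v extreme_point_of P" "V \<noteq> {}"
    and simple: "\<And>v. v \<in> V \<Longrightarrow> card {w\<in>W. w \<bullet> v = 1} \<le> DIM('a)"
    and simplicial: "\<And>w. w \<in> W \<Longrightarrow> card {v\<in>V. w \<bullet> v = 1} \<le> DIM('a)"
    and d: "DIM('a) \<ge> 3"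
  shows "int DIM('a) simplex P"
proof -
  let ?W = "\<lambda>v. {w\<in>W. w \<bullet> v = 1}"
  have V_in: "w \<bullet> p \<le> 1" if "w \<in> W" "p \<in> V" for w p
    using that hull_inc[of p V convex] V(2) P by auto
  have card_W: "card (?W v) = DIM('a)" if v: "v \<in> V" for v
  proof -
    have "dim (?W v) = DIM('a)"
      using extreme_point_tight_span[OF W P V(3)[OF v]] by (metis dim_UNIV dim_span)
    then have "DIM('a) \<le> card (?W v)"
      using W dim_le_card'[of "?W v"] by simp
    then show ?thesis using simple[OF v] by simp
  qed
  have neighbour: "\<exists>p. p \<in> V \<and> w \<bullet> p \<noteq> 1 \<and> (\<forall>w'\<in>?W v - {w}. w' \<bullet> p = 1)"
    if v: "v \<in> V" and "w \<in> ?W v" for v w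
  proof -
    have w: "w \<in> W" "w \<bullet> v = 1" using that(2) by auto
    obtain p where "p \<in> V" "w \<bullet> p \<noteq> 1" "\<And>w'. w' \<in> W \<Longrightarrow> w' \<bullet> v = 1 \<Longrightarrow> w' \<noteq> w \<Longrightarrow> w' \<bullet> p = 1"
      using simple_vertex_neighbour[OF W P V(1,2) V(3)[OF v] simple[OF v] w] by metis
    then show ?thesis by (intro exI[of _ p]) auto
  qed
  obtain v where v: "v \<in> V" using V(4) by blast
  have "\<forall>w\<in>?W v. \<exists>p. p \<in> V \<and> w \<bullet> p \<noteq> 1 \<and> (\<forall>w'\<in>?W v - {w}. w' \<bullet> p = 1)"
    using neighbour[OF v] by blast
  from bchoice[OF this] obtain N
    where N': "\<forall>w\<in>?W v. N w \<in> V \<and> w \<bullet> N w \<noteq> 1 \<and> (\<forall>w'\<in>?W v - {w}. w' \<bullet> N w = 1)"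
    by blast
  have N: "\<And>w. w \<in> ?W v \<Longrightarrow> N w \<in> V" "\<And>w. w \<in> ?W v \<Longrightarrow> w \<bullet> N w \<noteq> 1"
      "\<And>w w'. w \<in> ?W v \<Longrightarrow> w' \<in> ?W v \<Longrightarrow> w' \<noteq> w \<Longrightarrow> w' \<bullet> N w = 1"
    using N' by blast+
  have injN: "inj_on N (?W v)"
  proof (rule inj_onI, rule ccontr)
    fix w w' assume "w \<in> ?W v" "w' \<in> ?W v" "N w = N w'" "w \<noteq> w'"
    then show False using N(2)[of w'] N(3)[of w w'] by simp
  qed
  have v_notin: "v \<notin> N ` ?W v"
    using N(2) by auto
  have facet: "{p\<in>V. w \<bullet> p = 1} = insert v (N ` (?W v - {w}))" if w: "w \<in> ?W v" for w
  proof (rule sym, rule card_seteq)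
    show "finite {p\<in>V. w \<bullet> p = 1}" using V(1) by simp
    show "insert v (N ` (?W v - {w})) \<subseteq> {p\<in>V. w \<bullet> p = 1}"
      using v w N(1,3) by auto
    have "card (N ` (?W v - {w})) = DIM('a) - 1"
      using card_W[OF v] w W injN by (subst card_image) (auto intro: inj_on_subset)
    then have "card (insert v (N ` (?W v - {w}))) = DIM('a)"
      using v_notin W d by (subst card_insert_disjoint) auto
    then show "card {p\<in>V. w \<bullet> p = 1} \<le> card (insert v (N ` (?W v - {w})))"
      using simplicial[of w] w by simp
  qed
  have "?W v \<noteq> {}" using card_W[OF v] d by (metis card.empty not_numeral_le_zero)
  then obtain w0 where w0: "w0 \<in> ?W v" by blast
  let ?q = "N w0"
  have q: "?q \<in> V" by (rule N(1)[OF w0])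
  \<comment> \<open>\<open>?q\<close> has as many tight inequalities as \<open>v\<close>, so those
    of \<open>v\<close> without \<open>w0\<close> cannot account for all of them; \<open>g\<close>
    is one that is left over.\<close>
  have "\<not> ?W ?q \<subseteq> ?W v - {w0}"
  proof
    assume sub: "?W ?q \<subseteq> ?W v - {w0}"
    have "card (?W ?q) \<le> card (?W v - {w0})"
      using W by (intro card_mono sub) auto
    also have "\<dots> < card (?W v)"
      using W w0 by (intro psubset_card_mono) auto
    finally show False using card_W[OF v] card_W[OF q] by simp
  qed
  then obtain g where g: "g \<in> W" "g \<bullet> ?q = 1" "g \<bullet> v \<noteq> 1"
    using N(2)[OF w0] by blast
  have gN: "g \<bullet> N w = 1" if w: "w \<in> ?W v" for w
  proof (cases "w = w0")
    case False
    have "w \<in> ?W ?q" using N(3)[OF w0 w False] w by simp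
    then obtain p where p: "p \<in> V" "w \<bullet> p \<noteq> 1" "\<And>w'. w' \<in> ?W ?q - {w} \<Longrightarrow> w' \<bullet> p = 1"
      using neighbour[OF q] by blast
    \<comment> \<open>Here the dimension matters: a third facet \<open>w'\<close> through
      \<open>v\<close> contains both \<open>?q\<close> and \<open>p\<close>, and its vertices are
      known from \<open>facet\<close>.\<close>
    have "\<not> ?W v \<subseteq> {w, w0}"
    proof
      assume "?W v \<subseteq> {w, w0}"
      then have "card (?W v) \<le> card {w, w0}" by (intro card_mono) auto
      also have "\<dots> \<le> 2" by (simp add: card_insert_le_m1)
      finally show False using card_W[OF v] d by simp
    qed
    then obtain w' where w': "w' \<in> ?W v" "w' \<noteq> w" "w' \<noteq> w0" by blast
    have "w' \<bullet> p = 1"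
      using p(3)[of w'] N(3)[OF w0 w'(1,3)] w' by simp
    then have "p \<in> insert v (N ` (?W v - {w'}))"
      using facet[OF w'(1)] p(1) by blast
    \<comment> \<open>Every other candidate lies on \<open>w\<close>.\<close>
    then have "p = N w"
      using p(2) w N(3) by auto
    moreover have "g \<noteq> w" using g(3) w by auto
    ultimately show ?thesis using p(3)[of g] g by simp
  qed (use g in simp)
  define S where "S = insert v (N ` ?W v)"
  \<comment> \<open>\<open>f\<close> gives the facet opposite to each vertex: \<open>g\<close> for
    \<open>v\<close>, and \<open>w\<close> for \<open>N w\<close>.\<close>
  define f where "f s = (if s = v then g else inv_into (?W v) N s)" for s
  have fv: "f v = g" by (simp add: f_def)
  have fN: "f (N w) = w" if "w \<in> ?W v" for w
    using that v_notin injN by (auto simp: f_def inv_into_f_f)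
  have fW: "f s \<in> W" if "s \<in> S" for s
    using that fv fN g(1) by (auto simp: S_def)
  have SV: "S \<subseteq> V" using v N(1) by (auto simp: S_def)
  have "\<not> affine_dependent S \<and> P = convex hull S"
  proof (rule simplex_of_opposite_inequalities)
    show card: "card S = DIM('a) + 1"
      using v_notin W card_W[OF v] injN by (simp add: S_def card_image)
    show "convex hull S \<subseteq> P" unfolding V(2) by (rule hull_mono[OF SV])
    show "f s \<bullet> s' = 1" if "s \<in> S" "s' \<in> S" "s' \<noteq> s" for s s'
    proof (cases "s = v")
      case True
      then show ?thesis using that gN by (auto simp: S_def fv)
    next
      case False
      then obtain w where "w \<in> ?W v" "s = N w" using \<open>s \<in> S\<close> by (auto simp: S_def)
      then show ?thesis using that N(3) fN by (auto simp: S_def)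
    qed
    show "f s \<bullet> s < 1" if s: "s \<in> S" for s
    proof -
      have "f s \<bullet> s \<noteq> 1" using s fv fN g(3) N(2) by (auto simp: S_def)
      then show ?thesis using V_in[OF fW[OF s]] SV s by force
    qed
    show "f s \<bullet> y \<le> 1" if "s \<in> S" "y \<in> P" for s y
      using fW that by (auto simp: P)
  qed
  moreover have "card S = DIM('a) + 1"
    using v_notin W card_W[OF v] injN by (simp add: S_def card_image)
  ultimately show ?thesis
    unfolding simplex_def by (intro exI[of _ S]) simp
qed

text \<open>Facets arise by deleting one vertex, and distinct deletions give distinct facets because
  no vertex lies in the affine hull of the others. For \<open>n = 0\<close> a deletion leaves the
  empty set, which is no facet.\<close>

lemma card_facets_simplex:
  fixes P :: "'a :: euclidean_space set"
  assumes "int n simplex P" "n \<ge> 1"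
  shows "card {F. F facet_of P} = n + 1"
proof -
  obtain S where S: "\<not> affine_dependent S" "card S = n + 1" "P = convex hull S"
    using assms by (auto simp: simplex_def)
  have "inj_on (\<lambda>u. convex hull (S - {u})) S"
  proof (rule inj_onI, rule ccontr)
    fix a b assume ab: "a \<in> S" "b \<in> S" "convex hull (S - {a}) = convex hull (S - {b})" "a \<noteq> b"
    then have "a \<in> convex hull (S - {a})" by (simp add: hull_inc)
    then have "a \<in> affine hull (S - {a})" using convex_hull_subset_affine_hull by blast
    then show False using S(1) ab(1) by (auto simp: affine_dependent_def)
  qed
  moreover have "{F. F facet_of P} = (\<lambda>u. convex hull (S - {u})) ` S"
  proof -
    have "convex hull (S - {u}) \<noteq> {}" if "u \<in> S" for u
    proof
      assume "convex hull (S - {u}) = {}"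
      then have "S = {u}" using that by auto
      then show False using S(2) assms(2) by simp
    qed
    then show ?thesis
      using facet_of_convex_hull_affine_independent[OF S(1)] S(3) by auto
  qed
  ultimately show ?thesis using S(2) by (simp add: card_image)
qed

section \<open>Polar duality\<close>

lemma polar_convex_hull: "polar (convex hull S) = polar S"
proof -
  have "S \<subseteq> {y. z \<bullet> y \<le> 1} \<Longrightarrow> convex hull S \<subseteq> {y. z \<bullet> y \<le> 1}" for z
    by (intro hull_minimal convex_halfspace_le)
  then show ?thesis
    using hull_subset[of S convex] unfolding polar_def by blast
qed

lemma polar_polar:
  assumes "closed P" "convex P" "0 \<in> P"
  shows "polar (polar P) = P"
proof
  show "P \<subseteq> polar (polar P)" by (auto simp: polar_def inner_commute)
  show "polar (polar P) \<subseteq> P"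
  proof (rule subsetI, rule ccontr)
    fix z assume z: "z \<in> polar (polar P)" and "z \<notin> P"
    then obtain a b where ab: "a \<bullet> z < b" "\<forall>x\<in>P. a \<bullet> x > b"
      using separating_hyperplane_closed_point[OF assms(2,1)] by blast
    then have "b < 0" using assms(3) by force
    \<comment> \<open>Since \<open>b\<close> is negative, dividing by it reverses both inequalities:
      the scaled functional is at most 1 on \<open>P\<close> and exceeds 1 at
      \<open>z\<close>.\<close>
    have "a /\<^sub>R b \<in> polar P"
      using ab(2) \<open>b < 0\<close> by (auto simp: polar_def field_simps less_imp_le)
    then have "z \<bullet> (a /\<^sub>R b) \<le> 1" using z unfolding polar_def[of "polar P"] by blast
    then show False using ab(1) \<open>b < 0\<close> by (simp add: field_simps inner_commute)
  qed
qed

text \<open>The polar always contains 0, and a positive multiple of an orthogonal map sends only 0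
  to 0.\<close>

lemma self_polar_imp_zero_in:
  assumes "self_polar_up_to_scale P"
  shows "0 \<in> P"
proof -
  from assms obtain c U where cU: "c > 0" "orthogonal_transformation U" "polar P = (\<lambda>y. c *\<^sub>R U y) ` P"
    unfolding self_polar_up_to_scale_def by blast
  have "0 \<in> polar P" by (simp add: polar_def)
  then obtain y where "y \<in> P" "c *\<^sub>R U y = 0" using cU(3) by auto
  then show ?thesis
    using cU(1) orthogonal_transformation_norm[OF cU(2), of y] by simp
qed

text \<open>The face lies in a hyperplane missing the origin, so adjoining the origin raises its
  affine dimension by one; by the spanning hypothesis the result has full dimension.\<close>

lemma tight_face_facet:
  fixes P :: "'a :: euclidean_space set"
  assumes "convex P" and full: "interior P \<noteq> {}" and valid: "\<And>y. y \<in> P \<Longrightarrow> w \<bullet> y \<le> 1"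
    and span: "span {y \<in> P. w \<bullet> y = 1} = UNIV"
  shows "{y \<in> P. w \<bullet> y = 1} facet_of P"
proof -
  let ?F = "{y \<in> P. w \<bullet> y = 1}"
  have "?F face_of P"
    using face_of_Int_supporting_hyperplane_le[OF assms(1), of w 1] valid
    by (auto simp: Int_def)
  moreover have "?F \<noteq> {}"
  proof
    assume "?F = {}"
    then have "(UNIV :: 'a set) = {0}" using span by (metis span_empty)
    then show False using dim_UNIV[where 'a='a] dim_singleton[of "0 :: 'a"] by simp
  qed
  moreover have "aff_dim ?F = DIM('a) - 1"
  proof -
    have "affine hull ?F \<subseteq> {y. w \<bullet> y = 1}"
      by (intro hull_minimal affine_hyperplane) auto
    then have "0 \<notin> affine hull ?F" by auto
    then have "aff_dim (insert 0 ?F) = aff_dim ?F + 1" by (simp add: aff_dim_insert)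
    moreover have "aff_dim (insert 0 ?F) = int (dim (insert 0 ?F))"
      by (intro aff_dim_zero hull_inc) simp
    moreover have "dim (insert 0 ?F) = DIM('a)"
      using span by (metis dim_UNIV dim_span span_insert_0)
    ultimately show ?thesis by simp
  qed
  moreover have "aff_dim P = DIM('a)"
    using full by (rule aff_dim_nonempty_interior)
  ultimately show ?thesis by (simp add: facet_of_def)
qed

lemma simple_self_polar_simplex:
  fixes P :: "(real ^ 'n) set"
  assumes d: "CARD('n) \<ge> 3" and poly: "polytope P" and int: "interior P \<noteq> {}"
    and simple: "simple_polytope P" and self: "self_polar_up_to_scale P"
  shows "int CARD('n) simplex P"
proof -
  from self obtain c U where c: "c > 0" and U: "orthogonal_transformation U"
    and cU: "polar P = (\<lambda>y. c *\<^sub>R U y) ` P"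
    unfolding self_polar_up_to_scale_def by blast
  define h where "h = (\<lambda>y. c *\<^sub>R U y)"
  have linU: "linear U" by (rule orthogonal_transformation_linear[OF U])
  have linh: "linear h" unfolding h_def by (intro linear_compose_scale_right linU)
  have injh: "inj h"
    using orthogonal_transformation_inj[OF U] c by (auto simp: h_def inj_def)
  have comp: "compact P" and conv: "convex P"
    using poly by (auto intro: polytope_imp_compact polytope_imp_convex)
  have polar: "polar P = h ` P" using cU by (simp add: h_def)
  define V where "V = {v. v extreme_point_of P}"
  have finV: "finite V"
    unfolding V_def using poly by (intro finite_polyhedron_extreme_points polytope_imp_polyhedron)
  have PV: "P = convex hull V"
    unfolding V_def by (rule Krein_Milman_Minkowski[OF comp conv])
  define W where "W = h ` V"
  have finW: "finite W" by (simp add: W_def finV)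
  have polarW: "polar P = convex hull W"
    unfolding polar W_def using convex_hull_linear_image[OF linh, of V] PV by simp
  have bipolar: "polar (polar P) = P"
    using self comp conv
    by (intro polar_polar self_polar_imp_zero_in compact_imp_closed)
  have PW: "P = {y. \<forall>w\<in>W. w \<bullet> y \<le> 1}"
  proof -
    have "P = polar (convex hull W)"
      using bipolar polarW by simp
    also have "\<dots> = {y. \<forall>w\<in>W. w \<bullet> y \<le> 1}"
      unfolding polar_convex_hull by (auto simp: polar_def inner_commute)
    finally show ?thesis .
  qed
  have polarV: "polar P = {z. \<forall>v\<in>V. v \<bullet> z \<le> 1}"
  proof -
    have "polar P = polar V" by (subst PV) (rule polar_convex_hull)
    then show ?thesis by (simp add: polar_def inner_commute)
  qed
  have extW: "w extreme_point_of polar P" if "w \<in> W" for w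
  proof -
    from that obtain v where v: "v extreme_point_of P" "w = h v" by (auto simp: W_def V_def)
    then have "h ` {v} face_of h ` P"
      using face_of_linear_image[OF linh injh] face_of_singleton by metis
    then show ?thesis using v by (simp add: face_of_singleton polar)
  qed
  have validW: "w \<bullet> y \<le> 1" if "w \<in> W" "y \<in> P" for w y
    using PW that by blast
  have VP: "V \<subseteq> P" by (auto simp: V_def extreme_point_of_def)
  \<comment> \<open>A statement about a vertex of the polar: \<open>w\<close> is extreme there, and
    the inequalities tight at \<open>w\<close> are given by the vertices of \<open>P\<close> on its
    face.\<close>
  have span: "span {y \<in> P. w \<bullet> y = 1} = UNIV" if w: "w \<in> W" for w
  proof -
    have "span {v \<in> V. v \<bullet> w = 1} = UNIV"
      by (rule extreme_point_tight_span[OF finV polarV extW[OF w]])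
    moreover have "span {v \<in> V. v \<bullet> w = 1} \<subseteq> span {y \<in> P. w \<bullet> y = 1}"
      using VP by (intro span_mono) (auto simp: inner_commute)
    ultimately show ?thesis by auto
  qed
  \<comment> \<open>A tight set that spans the space determines \<open>w\<close>. Simplicity counts
    facets, and this turns the count into a bound on tight elements of \<open>W\<close>.\<close>
  have injF: "inj_on (\<lambda>w. {y \<in> P. w \<bullet> y = 1}) W"
  proof (rule inj_onI)
    fix w w' assume w: "w \<in> W" "w' \<in> W" and eq: "{y \<in> P. w \<bullet> y = 1} = {y \<in> P. w' \<bullet> y = 1}"
    have "{y \<in> P. w \<bullet> y = 1} \<subseteq> {y. (w - w') \<bullet> y = 0}"
      using eq by (auto simp: inner_diff_left)
    then have "span {y \<in> P. w \<bullet> y = 1} \<subseteq> {y. (w - w') \<bullet> y = 0}"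
      by (intro span_minimal subspace_hyperplane)
    then have "(w - w') \<bullet> (w - w') = 0" using span[OF w(1)] by blast
    then show "w = w'" by simp
  qed
  have cardW: "card {w \<in> W. w \<bullet> v = 1} \<le> CARD('n)" if v: "v \<in> V" for v
  proof -
    let ?Fv = "{F. F facet_of P \<and> v \<in> F}"
    have "aff_dim P = CARD('n)"
      using aff_dim_nonempty_interior[OF int] by simp
    then have "card ?Fv = CARD('n)"
      using simple v by (simp add: simple_polytope_def V_def)
    moreover have "card {w \<in> W. w \<bullet> v = 1} \<le> card ?Fv"
    proof (rule card_inj_on_le)
      show "inj_on (\<lambda>w. {y \<in> P. w \<bullet> y = 1}) {w \<in> W. w \<bullet> v = 1}"
        using injF by (rule inj_on_subset) auto
      show "(\<lambda>w. {y \<in> P. w \<bullet> y = 1}) ` {w \<in> W. w \<bullet> v = 1} \<subseteq> ?Fv"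
        using tight_face_facet[OF conv int] validW span v VP by auto
      show "finite ?Fv"
        using finite_polytope_facets[OF poly] by (rule rev_finite_subset) auto
    qed
    ultimately show ?thesis by simp
  qed
  have cardV: "card {v \<in> V. w \<bullet> v = 1} \<le> CARD('n)" if w: "w \<in> W" for w
  proof -
    \<comment> \<open>\<open>h'\<close> is the adjoint of \<open>h\<close>, as the inverse of an
      orthogonal map is its transpose. For \<open>w = h v0\<close>, a vertex \<open>v\<close> on
      \<open>w\<close> satisfies \<open>v0 \<bullet> h' v = 1\<close>, so it becomes an inequality
      tight at \<open>v0\<close>.\<close>
    define h' where "h' = (\<lambda>y. c *\<^sub>R inv U y)"
    have Ui: "orthogonal_transformation (inv U)" by (rule orthogonal_transformation_inv[OF U])
    have linh': "linear h'"
      unfolding h'_def by (intro linear_compose_scale_right orthogonal_transformation_linear[OF Ui])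
    have injh': "inj h'"
      using orthogonal_transformation_inj[OF Ui] c by (auto simp: h'_def inj_def)
    have adj: "h x \<bullet> y = x \<bullet> h' y" for x y
    proof -
      have "U x \<bullet> U (inv U y) = x \<bullet> inv U y"
        using U by (simp add: orthogonal_transformation_def)
      then show ?thesis
        by (simp add: h_def h'_def surj_f_inv_f[OF orthogonal_transformation_surj[OF U]])
    qed
    \<comment> \<open>Membership in the bipolar is a condition on \<open>h x \<bullet> y\<close>;
      moving \<open>h\<close> across the product makes it one on \<open>h' y\<close>. Hence
      \<open>h'\<close> too maps \<open>P\<close> onto the polar, and vertices into
      \<open>W\<close>.\<close>
    have mem: "h' y \<in> polar P \<longleftrightarrow> y \<in> P" for y
    proof -
      have "y \<in> P \<longleftrightarrow> y \<in> polar (polar P)"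
        using bipolar by simp
      also have "\<dots> \<longleftrightarrow> (\<forall>x\<in>P. h x \<bullet> y \<le> 1)"
        unfolding polar by (auto simp: polar_def inner_commute)
      also have "\<dots> \<longleftrightarrow> h' y \<in> polar P"
        by (simp only: adj polar_def mem_Collect_eq inner_commute[of "h' y"])
      finally show ?thesis ..
    qed
    have "polar P = h' ` P"
    proof
      show "h' ` P \<subseteq> polar P" using mem by auto
      show "polar P \<subseteq> h' ` P"
      proof
        fix z assume "z \<in> polar P"
        moreover have "z = h' (U z /\<^sub>R c)"
          using c inv_f_f[OF orthogonal_transformation_inj[OF U]]
          by (simp add: h'_def linear_scale[OF orthogonal_transformation_linear[OF Ui]])
        ultimately show "z \<in> h' ` P" using mem by (metis imageI)
      qed
    qed
    then have h'W: "h' v \<in> W" if "v \<in> V" for v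
    proof -
      have "{h' v} face_of polar P"
        using that face_of_linear_image[OF linh' injh', of "{v}" P] \<open>polar P = h' ` P\<close>
        by (simp add: V_def face_of_singleton)
      then show ?thesis
        unfolding polarW face_of_singleton by (rule extreme_point_of_convex_hull)
    qed
    obtain v0 where v0: "v0 \<in> V" "w = h v0" using w by (auto simp: W_def)
    have "card {v \<in> V. w \<bullet> v = 1} \<le> card {w' \<in> W. w' \<bullet> v0 = 1}"
    proof (rule card_inj_on_le)
      show "inj_on h' {v \<in> V. w \<bullet> v = 1}" using injh' by (rule inj_on_subset) auto
      show "h' ` {v \<in> V. w \<bullet> v = 1} \<subseteq> {w' \<in> W. w' \<bullet> v0 = 1}"
        using h'W by (auto simp: v0(2) adj inner_commute[of "h' y" for y])
    qed (simp add: finW)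
    then show ?thesis using cardW[OF v0(1)] by simp
  qed
  have "V \<noteq> {}" using int PV by auto
  then show ?thesis
    using simple_simplicial_simplex[OF finW PW finV PV] cardW cardV d by (auto simp: V_def)
qed

subsection \<open>Moments of spherical designs\<close>

text \<open>Up to a factor, the surface measure is the image under \<open>sgn\<close> of Lebesgue
  measure on the punctured ball. An orthogonal map preserves that ball and commutes with
  \<open>sgn\<close>, so invariance descends to the sphere.\<close>

lemma sphere_sigma_invariant:
  fixes f :: "real ^ 'n \<Rightarrow> real ^ 'n" and p :: "real ^ 'n \<Rightarrow> real"
  assumes f: "orthogonal_transformation f" and inv: "distr lborel borel f = lborel"
    and p: "p \<in> borel_measurable borel"
  shows "(LINT u|sphere_sigma. p (f u)) = (LINT u|sphere_sigma. p u)"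
proof -
  let ?B = "ball 0 1 - {0} :: (real ^ 'n) set"
  let ?M = "sphere_area_measure :: (real ^ 'n) measure"
  have lin: "linear f" by (rule orthogonal_transformation_linear[OF f])
  have fb[measurable]: "f \<in> borel_measurable borel"
    using lin by (simp add: linear_continuous_on borel_measurable_continuous_onI linear_conv_bounded_linear)
  have nf: "norm (f x) = norm x" for x by (rule orthogonal_transformation_norm[OF f])
  have sgnf: "sgn (f x) = f (sgn x)" for x
    by (simp add: sgn_div_norm nf linear_scale[OF lin])
  have sgnb: "sgn \<in> borel_measurable (borel :: (real^'n) measure)"
    unfolding sgn_div_norm by measurable
  have sM: "sets ?M = sets borel"
    by (simp add: sphere_area_measure_def)
  have eM: "emeasure ?M B = of_nat CARD('n) * emeasure lborel (sgn -` B \<inter> ?B)"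
    if "B \<in> sets borel" for B
  proof -
    have "sgn \<in> borel_measurable (restrict_space lborel ?B)"
      using sgnb by (intro measurable_restrict_space1) simp
    then show ?thesis
      using that by (simp add: sphere_area_measure_def emeasure_distr emeasure_restrict_space space_restrict_space)
  qed
  have fB: "f -` B \<in> sets borel" if "B \<in> sets borel" for B
    using measurable_sets[OF fb that] by simp
  have invM: "emeasure ?M (f -` B) = emeasure ?M B" if B: "B \<in> sets borel" for B
  proof -
    have "sgn -` B \<inter> ?B \<in> sets borel"
      using measurable_sets[OF sgnb B] by simp
    moreover have "f -` (sgn -` B \<inter> ?B) = sgn -` (f -` B) \<inter> ?B"
      by (auto simp: sgnf nf) (use nf norm_zero in \<open>metis norm_eq_zero\<close>)+
    ultimately have "emeasure lborel (sgn -` B \<inter> ?B) = emeasure lborel (sgn -` (f -` B) \<inter> ?B)"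
      by (subst inv[symmetric]) (simp add: emeasure_distr)
    then show ?thesis
      using B fB by (simp add: eM)
  qed
  have sS: "sets (sphere_sigma :: (real^'n) measure) = sets borel"
    by (simp add: sphere_sigma_def sM)
  have sph: "sphere 0 1 \<in> sets (borel :: (real^'n) measure)"
    by (simp add: borel_closed)
  have fS: "f \<in> measurable sphere_sigma borel"
    using fb by (simp add: measurable_cong_sets[OF sS refl])
  have "distr sphere_sigma borel f = sphere_sigma"
  proof (rule measure_eqI)
    show "sets (distr sphere_sigma borel f) = sets (sphere_sigma :: (real^'n) measure)"
      by (simp add: sS)
    fix A assume "A \<in> sets (distr sphere_sigma borel f)"
    then have A: "A \<in> sets borel" by simp
    have "space (sphere_sigma :: (real^'n) measure) = UNIV"
      using sets_eq_imp_space_eq[OF sS] by simp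
    then have "emeasure (distr sphere_sigma borel f) A = emeasure (sphere_sigma) (f -` A)"
      using A by (simp add: emeasure_distr[OF fS])
    also have "\<dots> = emeasure ?M (sphere 0 1 \<inter> f -` A) / emeasure ?M (sphere 0 1)"
      using fB[OF A] sph by (simp add: sphere_sigma_def sM)
    also have "sphere 0 1 \<inter> f -` A = f -` (sphere 0 1 \<inter> A)"
      by (auto simp: nf)
    also have "emeasure ?M \<dots> = emeasure ?M (sphere 0 1 \<inter> A)"
      using A sph by (intro invM) auto
    also have "\<dots> / emeasure ?M (sphere 0 1) = emeasure sphere_sigma A"
      using A sph by (simp add: sphere_sigma_def sM)
    finally show "emeasure (distr sphere_sigma borel f) A = emeasure sphere_sigma A" .
  qed
  then have "(LINT u|sphere_sigma. p u) = (LINT u|distr sphere_sigma borel f. p u)"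
    by simp
  also have "\<dots> = (LINT u|sphere_sigma. p (f u))"
    by (rule integral_distr[OF fS p])
  finally show ?thesis ..
qed

section \<open>Coordinate symmetries of Lebesgue measure\<close>

text \<open>One family covers the antipodal map (\<open>A = UNIV\<close>), used for odd moments, and
  the reflection in a single coordinate, used for mixed second moments.\<close>

definition flip_coords :: "'n set \<Rightarrow> real ^ 'n \<Rightarrow> real ^ 'n" where
  "flip_coords A x = (\<chi> k. if k \<in> A then - x $ k else x $ k)"

lemma orthogonal_flip_coords: "orthogonal_transformation (flip_coords A)"
proof -
  have "linear (flip_coords A)"
    by (rule linearI) (auto simp: flip_coords_def vec_eq_iff)
  then show ?thesis
    unfolding orthogonal_transformation_def
    by (auto simp: inner_vec_def flip_coords_def intro!: sum.cong)
qed

lemma lborel_distr_flip_coords: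
  fixes A :: "'n::finite set"
  shows "distr lborel borel (flip_coords A) = lborel"
proof -
  define c :: "real ^ 'n \<Rightarrow> real" where "c j = (if j \<in> (\<lambda>k. axis k 1) ` A then - 1 else 1)" for j
  have T: "(\<lambda>x. 0 + (\<Sum>j\<in>Basis. (c j * (x \<bullet> j)) *\<^sub>R j)) = flip_coords A"
  proof
    fix x :: "real ^ 'n"
    have "(0 + (\<Sum>j\<in>Basis. (c j * (x \<bullet> j)) *\<^sub>R j)) $ k = flip_coords A x $ k" for k
    proof -
      have "axis k (1::real) \<in> Basis"
        by (simp add: axis_in_Basis_iff Basis_real_def)
      then have "(0 + (\<Sum>j\<in>Basis. (c j * (x \<bullet> j)) *\<^sub>R j)) \<bullet> axis k 1 = c (axis k 1) * (x \<bullet> axis k 1)"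
        by (simp add: inner_sum_left_Basis)
      then show ?thesis
        by (auto simp: inner_axis flip_coords_def c_def axis_eq_axis)
    qed
    then show "(0 + (\<Sum>j\<in>Basis. (c j * (x \<bullet> j)) *\<^sub>R j)) = flip_coords A x"
      by (simp add: vec_eq_iff)
  qed
  have c0: "c j \<noteq> 0" "\<bar>c j\<bar> = 1" for j by (auto simp: c_def)
  have "lborel = density (distr lborel borel (flip_coords A)) (\<lambda>_. \<Prod>j\<in>Basis. \<bar>c j\<bar>)"
    by (rule lborel_affine_euclidean[where c=c and t=0, unfolded T]) (simp add: c0)
  then show ?thesis
    by (simp add: c0 density_1)
qed

definition swap_coords :: "'n \<Rightarrow> 'n \<Rightarrow> real ^ 'n \<Rightarrow> real ^ 'n" where
  "swap_coords i j x = (\<chi> k. x $ Transposition.transpose i j k)"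

lemma orthogonal_swap_coords: "orthogonal_transformation (swap_coords i j)"
proof -
  have "linear (swap_coords i j)"
    by (rule linearI) (auto simp: swap_coords_def vec_eq_iff)
  moreover have "(\<Sum>k\<in>UNIV. v $ Transposition.transpose i j k * w $ Transposition.transpose i j k) = (\<Sum>k\<in>UNIV. v $ k * w $ k)"
    for v w :: "real ^ 'a"
    by (rule sum.reindex_bij_betw[OF bij_transpose, of "\<lambda>k. v $ k * w $ k"])
  ultimately show ?thesis
    unfolding orthogonal_transformation_def
    by (simp add: inner_vec_def swap_coords_def)
qed

text \<open>Boxes determine Lebesgue measure, and a transposition of coordinates only permutes the
  side lengths of a box.\<close>

lemma lborel_distr_swap_coords: "distr lborel borel (swap_coords i j) = (lborel :: (real ^ 'n) measure)"
proof (rule lborel_eqI[symmetric])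
  let ?t = "Transposition.transpose i j"
  have lin: "linear (swap_coords i j :: real ^ 'n \<Rightarrow> _)"
    by (rule orthogonal_transformation_linear[OF orthogonal_swap_coords])
  have mb: "swap_coords i j \<in> borel_measurable (borel :: (real^'n) measure)"
    using lin by (simp add: linear_continuous_on borel_measurable_continuous_onI linear_conv_bounded_linear)
  have prod_Basis: "(\<Prod>b\<in>Basis. w \<bullet> b) = (\<Prod>k\<in>UNIV. w $ k)" for w :: "real ^ 'n"
  proof -
    have "inj (\<lambda>k. axis k (1::real) :: real ^ 'n)"
      by (auto simp: inj_on_def axis_eq_axis)
    moreover have "range (\<lambda>k. axis k (1::real) :: real ^ 'n) = Basis"
      by (auto simp: Basis_vec_def)
    ultimately have "bij_betw (\<lambda>k. axis k (1::real) :: real ^ 'n) UNIV Basis"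
      by (simp add: bij_betw_def)
    from prod.reindex_bij_betw[OF this, of "\<lambda>b. w \<bullet> b"] show ?thesis
      by (simp add: inner_axis)
  qed
  fix l u :: "real ^ 'n"
  assume lu: "\<And>b. b \<in> Basis \<Longrightarrow> l \<bullet> b \<le> u \<bullet> b"
  then have lu': "l $ k \<le> u $ k" for k
    using lu[of "axis k 1"] by (simp add: axis_in_Basis_iff Basis_real_def inner_axis)
  have pre: "swap_coords i j -` box l u = box (swap_coords i j l) (swap_coords i j u)"
    by (auto simp: mem_box_cart swap_coords_def) (metis transpose_involutory)+
  have "emeasure (distr lborel borel (swap_coords i j)) (box l u)
      = emeasure lborel (box (swap_coords i j l) (swap_coords i j u))"
    using mb by (simp add: emeasure_distr pre)
  also have "\<dots> = (\<Prod>b\<in>Basis. (swap_coords i j u - swap_coords i j l) \<bullet> b)"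
    using lu' by (intro emeasure_lborel_box) (auto simp: Basis_vec_def inner_axis swap_coords_def)
  also have "(\<Prod>b\<in>Basis. (swap_coords i j u - swap_coords i j l) \<bullet> b) = (\<Prod>b\<in>Basis. (u - l) \<bullet> b)"
    unfolding prod_Basis swap_coords_def
    using prod.reindex_bij_betw[OF bij_transpose, of "\<lambda>k. (u - l) $ k" i j] by simp
  finally show "emeasure (distr lborel borel (swap_coords i j)) (box l u) = (\<Prod>b\<in>Basis. (u - l) \<bullet> b)" .
qed simp

section \<open>Closure properties of polynomials of bounded degree\<close>

lemma polynomial_deg_le_monomial:
  assumes "(\<Sum>i\<in>UNIV. \<alpha> i) \<le> t"
  shows "polynomial_deg_le t (monomial_fun \<alpha>)"
  unfolding polynomial_deg_le_def
proof (intro exI ext)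
  fix x
  have "(\<Sum>\<beta> | (\<Sum>i\<in>UNIV. \<beta> i) \<le> t. of_bool (\<beta> = \<alpha>) * monomial_fun \<beta> x) = (\<Sum>\<beta>\<in>{\<alpha>}. of_bool (\<beta> = \<alpha>) * monomial_fun \<beta> x)"
    using assms by (intro sum.mono_neutral_right finite_multi_indices) auto
  then show "monomial_fun \<alpha> x = (\<Sum>\<beta> | (\<Sum>i\<in>UNIV. \<beta> i) \<le> t. of_bool (\<beta> = \<alpha>) * monomial_fun \<beta> x)"
    by simp
qed

lemma polynomial_deg_le_scale:
  assumes "polynomial_deg_le t p"
  shows "polynomial_deg_le t (\<lambda>x. a * p x)"
proof -
  from assms obtain c where "p = (\<lambda>x. \<Sum>\<alpha> | (\<Sum>i\<in>UNIV. \<alpha> i) \<le> t. c \<alpha> * monomial_fun \<alpha> x)"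
    unfolding polynomial_deg_le_def ..
  then show ?thesis
    unfolding polynomial_deg_le_def
    by (intro exI[of _ "\<lambda>\<alpha>. a * c \<alpha>"]) (simp add: sum_distrib_left mult.assoc)
qed

lemma polynomial_deg_le_sum:
  assumes "\<And>k. k \<in> K \<Longrightarrow> polynomial_deg_le t (p k)"
  shows "polynomial_deg_le t (\<lambda>x. \<Sum>k\<in>K. p k x)"
proof -
  from assms have "\<forall>k\<in>K. \<exists>c. p k = (\<lambda>x. \<Sum>\<alpha> | (\<Sum>i\<in>UNIV. \<alpha> i) \<le> t. c \<alpha> * monomial_fun \<alpha> x)"
    unfolding polynomial_deg_le_def by blast
  then obtain c where c: "\<And>k. k \<in> K \<Longrightarrow> p k = (\<lambda>x. \<Sum>\<alpha> | (\<Sum>i\<in>UNIV. \<alpha> i) \<le> t. c k \<alpha> * monomial_fun \<alpha> x)"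
    by metis
  have "(\<Sum>k\<in>K. p k x) = (\<Sum>\<alpha> | (\<Sum>i\<in>UNIV. \<alpha> i) \<le> t. (\<Sum>k\<in>K. c k \<alpha>) * monomial_fun \<alpha> x)" for x
  proof -
    have "(\<Sum>k\<in>K. p k x) = (\<Sum>k\<in>K. \<Sum>\<alpha> | (\<Sum>i\<in>UNIV. \<alpha> i) \<le> t. c k \<alpha> * monomial_fun \<alpha> x)"
      by (intro sum.cong) (simp_all add: c)
    also have "\<dots> = (\<Sum>\<alpha> | (\<Sum>i\<in>UNIV. \<alpha> i) \<le> t. \<Sum>k\<in>K. c k \<alpha> * monomial_fun \<alpha> x)"
      by (rule sum.swap)
    finally show ?thesis by (simp add: sum_distrib_right)
  qed
  then show ?thesis
    unfolding polynomial_deg_le_def by (intro exI ext)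
qed

lemma polynomial_deg_le_mult:
  assumes "polynomial_deg_le s p" "polynomial_deg_le t q"
  shows "polynomial_deg_le (s + t) (\<lambda>x. p x * q x)"
proof -
  from assms obtain c e where
      c: "p = (\<lambda>x. \<Sum>\<alpha> | (\<Sum>i\<in>UNIV. \<alpha> i) \<le> s. c \<alpha> * monomial_fun \<alpha> x)"
    and e: "q = (\<lambda>x. \<Sum>\<alpha> | (\<Sum>i\<in>UNIV. \<alpha> i) \<le> t. e \<alpha> * monomial_fun \<alpha> x)"
    unfolding polynomial_deg_le_def by blast
  have "polynomial_deg_le (s + t) (\<lambda>x. \<Sum>\<alpha> | (\<Sum>i\<in>UNIV. \<alpha> i) \<le> s. \<Sum>\<beta> | (\<Sum>i\<in>UNIV. \<beta> i) \<le> t.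
      (c \<alpha> * e \<beta>) * monomial_fun (\<lambda>i. \<alpha> i + \<beta> i) x)"
    by (intro polynomial_deg_le_sum polynomial_deg_le_scale polynomial_deg_le_monomial)
      (auto simp: sum.distrib)
  then show ?thesis
    by (simp add: c e sum_product monomial_fun_def power_add prod.distrib mult_ac)
qed

lemma polynomial_deg_le_const: "polynomial_deg_le t (\<lambda>x. a)"
  using polynomial_deg_le_scale[OF polynomial_deg_le_monomial[of "\<lambda>_. 0" t], of a]
  by (simp add: monomial_fun_def)

text \<open>Multiplying by the constant 1, counted as a polynomial of degree at most
  \<open>t - s\<close>, raises the bound.\<close>

lemma polynomial_deg_le_mono:
  assumes "polynomial_deg_le s p" "s \<le> t"
  shows "polynomial_deg_le t p"
  using polynomial_deg_le_mult[OF assms(1) polynomial_deg_le_const[of "t - s" 1]] assms(2) by simp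

lemma polynomial_deg_le_nth: "polynomial_deg_le 1 (\<lambda>x. x $ i)"
proof -
  have "monomial_fun (\<lambda>k. of_bool (k = i)) = (\<lambda>x. x $ i)"
    by (auto simp: monomial_fun_def fun_eq_iff of_bool_def prod.If_cases if_distrib cong: if_cong)
  then show ?thesis
    using polynomial_deg_le_monomial[of "\<lambda>k. of_bool (k = i)" 1] by simp
qed

lemma polynomial_deg_le_inner: "polynomial_deg_le 1 (\<lambda>x. a \<bullet> x)"
  unfolding inner_vec_def inner_real_def
  by (intro polynomial_deg_le_sum polynomial_deg_le_scale polynomial_deg_le_nth)

lemma polynomial_deg_le_power:
  assumes "polynomial_deg_le s p"
  shows "polynomial_deg_le (k * s) (\<lambda>x. p x ^ k)"
  by (induction k) (auto intro: polynomial_deg_le_const polynomial_deg_le_mult assms)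

section \<open>Power sums and second moments of a design\<close>

lemma spherical_design_mono:
  assumes "spherical_design t X" "s \<le> t"
  shows "spherical_design s X"
  using assms polynomial_deg_le_mono unfolding spherical_design_def by blast

lemma spherical_design_sum:
  assumes "spherical_design t X" "X \<noteq> {}" "polynomial_deg_le t p"
  shows "(\<Sum>x\<in>X. p x) = card X * (LINT u|sphere_sigma. p u)"
proof -
  have "real (card X) \<noteq> 0" "(\<Sum>x\<in>X. p x) / real (card X) = (LINT u|sphere_sigma. p u)"
    using assms unfolding spherical_design_def by auto
  then show ?thesis by (simp add: field_simps)
qed

text \<open>The antipodal map preserves \<open>sphere_sigma\<close> and reverses the sign of the
  integrand. The case \<open>k = 1\<close> centres the design; \<open>k = 3\<close> serves against
  3-designs.\<close>

lemma design_odd_sum: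
  assumes X: "spherical_design t X" and t: "k \<le> t" and k: "odd k"
  shows "(\<Sum>x\<in>X. (a \<bullet> x) ^ k) = 0"
proof (cases "X = {}")
  case False
  have "(LINT u|sphere_sigma. (a \<bullet> flip_coords UNIV u) ^ k) = (LINT u|sphere_sigma. (a \<bullet> u) ^ k)"
    by (rule sphere_sigma_invariant[OF orthogonal_flip_coords lborel_distr_flip_coords]) measurable
  moreover have "flip_coords UNIV = (uminus :: real ^ 'a \<Rightarrow> _)"
    by (auto simp: flip_coords_def vec_eq_iff)
  ultimately have "(LINT u|sphere_sigma. (a \<bullet> u) ^ k) = 0"
    using k by simp
  moreover have "polynomial_deg_le t (\<lambda>x. (a \<bullet> x) ^ k)"
    using polynomial_deg_le_mono[OF polynomial_deg_le_power[OF polynomial_deg_le_inner]] t by simp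
  ultimately show ?thesis
    using spherical_design_sum[OF X False, of "\<lambda>x. (a \<bullet> x) ^ k"] by simp
qed auto

lemma design_sum_zero:
  assumes X: "spherical_design t X" and t: "1 \<le> t"
  shows "(\<Sum>x\<in>X. x) = 0"
proof -
  have "a \<bullet> (\<Sum>x\<in>X. x) = 0" for a
    using design_odd_sum[OF X t, of a] by (simp add: inner_sum_right)
  from this[of "\<Sum>x\<in>X. x"] show ?thesis by simp
qed

text \<open>Transpositions make the diagonal sums equal, and their total is the sum of the squared
  norms, \<open>card X\<close>. Off the diagonal, reflecting coordinate \<open>i\<close> changes the
  sign of the integrand.\<close>

lemma design_coord_product:
  fixes X :: "(real ^ 'n) set"
  assumes X: "spherical_design t X" and t: "2 \<le> t"
  shows "(\<Sum>x\<in>X. x $ i * x $ j) = (if i = j then card X / CARD('n) else 0)"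
proof (cases "X = {}")
  case False
  have poly: "polynomial_deg_le t (\<lambda>x :: real ^ 'n. x $ k * x $ l)" for k l
    using polynomial_deg_le_mono[OF polynomial_deg_le_mult[OF polynomial_deg_le_nth[of k] polynomial_deg_le_nth[of l]], of t] t by simp
  note sum_eq = spherical_design_sum[OF X False poly]
  show ?thesis
  proof (cases "i = j")
    case True
    have same: "(\<Sum>x\<in>X. x $ k * x $ k) = (\<Sum>x\<in>X. x $ i * x $ i)" for k
    proof -
      have "(LINT u|sphere_sigma. swap_coords i k u $ i * swap_coords i k u $ i)
          = (LINT u|sphere_sigma. (u :: real ^ 'n) $ i * u $ i)"
        by (rule sphere_sigma_invariant[OF orthogonal_swap_coords lborel_distr_swap_coords]) measurable
      then show ?thesis
        by (simp add: swap_coords_def sum_eq)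
    qed
    have "(\<Sum>k\<in>UNIV. \<Sum>x\<in>X. x $ k * x $ k) = (\<Sum>k\<in>(UNIV :: 'n set). \<Sum>x\<in>X. x $ i * x $ i)"
      by (rule sum.cong[OF refl]) (rule same)
    then have "CARD('n) * (\<Sum>x\<in>X. x $ i * x $ i) = (\<Sum>k\<in>UNIV. \<Sum>x\<in>X. x $ k * x $ k)"
      by simp
    also have "\<dots> = (\<Sum>x\<in>X. x \<bullet> x)"
      by (subst sum.swap) (simp add: inner_vec_def)
    also have "\<dots> = card X"
      using X by (auto simp: spherical_design_def dot_square_norm subset_iff)
    finally show ?thesis using True by (simp add: field_simps)
  next
    case False
    have "(LINT u|sphere_sigma. flip_coords {i} u $ i * flip_coords {i} u $ j)
        = (LINT u|sphere_sigma. (u :: real ^ 'n) $ i * u $ j)"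
      by (rule sphere_sigma_invariant[OF orthogonal_flip_coords lborel_distr_flip_coords]) measurable
    then show ?thesis
      using False by (simp add: flip_coords_def sum_eq)
  qed
qed auto

lemma design_tight_frame:
  fixes X :: "(real ^ 'n) set"
  assumes "spherical_design t X" and "2 \<le> t"
  shows "(\<Sum>x\<in>X. (a \<bullet> x) *\<^sub>R x) = (card X / CARD('n)) *\<^sub>R a"
proof -
  have "(\<Sum>x\<in>X. (a \<bullet> x) *\<^sub>R x) $ j = ((card X / CARD('n)) *\<^sub>R a) $ j" for j
  proof -
    have "(\<Sum>x\<in>X. (a \<bullet> x) *\<^sub>R x) $ j = (\<Sum>x\<in>X. \<Sum>i\<in>UNIV. a $ i * (x $ i * x $ j))"
      by (simp add: inner_vec_def sum_distrib_right mult.assoc)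
    also have "\<dots> = (\<Sum>i\<in>UNIV. a $ i * (\<Sum>x\<in>X. x $ i * x $ j))"
      by (subst sum.swap) (simp add: sum_distrib_left)
    also have "\<dots> = (card X / CARD('n)) * a $ j"
      by (simp add: design_coord_product[OF assms] if_distrib cong: if_cong)
    finally show ?thesis by simp
  qed
  then show ?thesis by (simp add: vec_eq_iff)
qed

text \<open>The linear relations among \<open>d + 1\<close> vectors that span \<open>\<real>\<^sup>d\<close> and sum to \<open>0\<close> are the constant
  ones; the relation that the frame identity at \<open>x\<close> provides is therefore constant.\<close>

lemma design_gram:
  fixes X :: "(real ^ 'n) set"
  assumes X: "spherical_design t X" and t: "2 \<le> t" and card: "card X = CARD('n) + 1"
    and x: "x \<in> X" and y: "y \<in> X" and "x \<noteq> y"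
  shows "x \<bullet> y = - 1 / CARD('n)"
proof -
  have fin: "finite X" and unit: "\<And>z. z \<in> X \<Longrightarrow> z \<bullet> z = 1"
    using X by (auto simp: spherical_design_def dot_square_norm subset_iff)
  have sum0: "(\<Sum>x\<in>X. x) = 0"
    using design_sum_zero[OF X] t by simp
  have relation_const: "l y = l x" if l: "(\<Sum>z\<in>X. l z *\<^sub>R z) = 0" and x: "x \<in> X" and y: "y \<in> X" for l x y
  proof (rule ccontr)
    assume ne: "l y \<noteq> l x"
    \<comment> \<open>The frame identity shows that \<open>X\<close> spans. As the points sum to 0,
      dropping \<open>x\<close> loses nothing, and the remaining d points form a basis.\<close>
    let ?X = "X - {x}"
    have "x = - (\<Sum>z\<in>?X. z)"
      using sum0 sum.remove[OF fin x, of "\<lambda>z. z"] by (simp add: add_eq_0_iff2)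
    moreover have "\<dots> \<in> span ?X"
      by (intro span_neg span_sum span_base)
    ultimately have xs: "x \<in> span ?X" by metis
    have Xs: "X \<subseteq> span ?X"
    proof
      fix z assume "z \<in> X"
      then show "z \<in> span ?X" using xs by (cases "z = x") (auto intro: span_base)
    qed
    have "a \<in> span ?X" for a
    proof -
      have "(\<Sum>x\<in>X. (a \<bullet> x) *\<^sub>R x) \<in> span ?X"
        using Xs by (intro span_sum span_scale) auto
      from span_scale[OF this, of "CARD('n) / card X"] show ?thesis
        using card by (simp add: design_tight_frame[OF X t])
    qed
    then have "span ?X = UNIV" by auto
    then have ind: "independent ?X"
      using card fin x by (intro card_le_dim_spanning[of _ UNIV]) auto
    \<comment> \<open>Subtracting \<open>l x\<close> times the relation \<open>sum0\<close> removes
      the coefficient of \<open>x\<close> and leaves a relation within the basis.\<close>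
    have "(\<Sum>z\<in>?X. (l z - l x) *\<^sub>R z) = (\<Sum>z\<in>X. (l z - l x) *\<^sub>R z)"
      using sum.remove[OF fin x, of "\<lambda>z. (l z - l x) *\<^sub>R z"] by simp
    also have "\<dots> = (\<Sum>z\<in>X. l z *\<^sub>R z) - l x *\<^sub>R (\<Sum>z\<in>X. z)"
      by (simp add: scaleR_left_diff_distrib sum_subtractf scaleR_sum_right)
    also have "\<dots> = 0"
      by (simp add: l sum0)
    finally have "l y - l x = 0"
      using independentD[OF ind, of ?X "\<lambda>z. l z - l x" y] fin y ne by auto
    then show False using ne by simp
  qed
  \<comment> \<open>The frame identity at \<open>x\<close>, written as a relation: its coefficient
    at \<open>x\<close> is 1 - (d + 1)/d = -1/d, and at any other \<open>y\<close> it is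
    \<open>x \<bullet> y\<close>.\<close>
  let ?l = "\<lambda>z. x \<bullet> z - (if z = x then card X / CARD('n) else 0)"
  have "(\<Sum>z\<in>X. ?l z *\<^sub>R z) = (\<Sum>z\<in>X. (x \<bullet> z) *\<^sub>R z) - (\<Sum>z\<in>X. (if z = x then card X / CARD('n) else 0) *\<^sub>R z)"
    by (simp add: scaleR_left_diff_distrib sum_subtractf)
  also have "(\<Sum>z\<in>X. (if z = x then card X / CARD('n) else 0) *\<^sub>R z) = (card X / CARD('n)) *\<^sub>R x"
    using fin x by (simp add: if_distrib[of "\<lambda>r. r *\<^sub>R _"] cong: if_cong)
  finally have "(\<Sum>z\<in>X. ?l z *\<^sub>R z) = 0"
    by (simp add: design_tight_frame[OF X t])
  from relation_const[OF this x y] show ?thesis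
    using \<open>x \<noteq> y\<close> card unit[OF x] by (auto simp: field_simps)
qed

text \<open>The Gram matrix is (1 + 1/d) I - (1/d) J with J the all-ones matrix. J annihilates the
  coefficients of an affine relation, so pairing the relation with \<open>y\<close> leaves (1 + 1/d)
  times \<open>l y\<close>. The common squared distance is 2 - 2 (-1/d).\<close>

lemma design_regular_simplex:
  fixes X :: "(real ^ 'n) set"
  assumes X: "spherical_design t X" and t: "2 \<le> t" and card: "card X = CARD('n) + 1"
  shows "regular_simplex_vertices X"
proof -
  have fin: "finite X" and unit: "\<And>z. z \<in> X \<Longrightarrow> z \<bullet> z = 1"
    using X by (auto simp: spherical_design_def dot_square_norm subset_iff)
  have d0: "1 + 1 / real CARD('n) > 0" by (simp add: add_pos_pos)
  have "\<not> affine_dependent X"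
  proof
    assume "affine_dependent X"
    then obtain l y where l: "sum l X = 0" "(\<Sum>z\<in>X. l z *\<^sub>R z) = 0" and y: "y \<in> X" "l y \<noteq> 0"
      using affine_dependent_explicit_finite[OF fin] by auto
    have "0 = (\<Sum>z\<in>X. l z *\<^sub>R z) \<bullet> y" using l by simp
    also have "\<dots> = (\<Sum>z\<in>X. l z * (z \<bullet> y))" by (simp add: inner_sum_left)
    also have "\<dots> = (\<Sum>z\<in>X. l z * (if z = y then 1 + 1 / CARD('n) else 0) - l z / CARD('n))"
      using design_gram[OF X t card] unit y by (intro sum.cong) (auto simp: field_simps)
    also have "\<dots> = (\<Sum>z\<in>X. if z = y then l y * (1 + 1 / CARD('n)) else 0) - sum l X / CARD('n)"
      by (subst sum_divide_distrib, subst sum_subtractf[symmetric]) (intro sum.cong; simp)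
    also have "\<dots> = l y * (1 + 1 / CARD('n))"
      using fin y l by simp
    finally show False using y d0 by simp
  qed
  moreover have "dist x y = sqrt (2 + 2 / CARD('n))" if "x \<in> X" "y \<in> X" "x \<noteq> y" for x y
    using design_gram[OF X t card that] unit that
    by (simp add: dist_norm norm_eq_sqrt_inner inner_diff inner_commute)
  ultimately show ?thesis
    unfolding regular_simplex_vertices_def using fin by blast
qed

lemma design_card_not_3_design:
  fixes X :: "(real ^ 'n) set"
  assumes card: "card X = CARD('n) + 1" and d: "CARD('n) \<ge> 2"
  shows "\<not> spherical_design 3 X"
proof
  assume X: "spherical_design 3 X"
  have fin: "finite X" and unit: "\<And>z. z \<in> X \<Longrightarrow> z \<bullet> z = 1"
    using X by (auto simp: spherical_design_def dot_square_norm subset_iff)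
  obtain x where x: "x \<in> X" using card by fastforce
  have "0 = (\<Sum>z\<in>X. (x \<bullet> z) ^ 3)"
    using design_odd_sum[OF X, of 3] by simp
  also have "\<dots> = 1 + (\<Sum>z\<in>X - {x}. (x \<bullet> z) ^ 3)"
    using sum.remove[OF fin x, of "\<lambda>z. (x \<bullet> z) ^ 3"] unit[OF x] by simp
  also have "(\<Sum>z\<in>X - {x}. (x \<bullet> z) ^ 3) = (\<Sum>z\<in>X - {x}. (- 1 / CARD('n)) ^ 3)"
    using design_gram[OF X _ card x] by (intro sum.cong) auto
  \<comment> \<open>There are d equal terms -1/d^3.\<close>
  also have "\<dots> = - 1 / (real CARD('n))\<^sup>2"
    using card fin x by (simp add: power3_eq_cube power2_eq_square)
  finally have "(real CARD('n))\<^sup>2 = 1"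
    by (simp add: field_simps)
  then show False using d by (simp add: power2_eq_1_iff)
qed

subsection \<open>Minkowski polytopes of designs\<close>

theorem theorem8p3:
  fixes X P :: "(real ^ 'n) set" and t :: nat
  assumes "CARD('n) \<ge> 3"
    and "t \<ge> 2"
    and "spherical_design t X"
    and "minkowski_polytope X P"
    and "steiner_point P = 0"
    and "simple_polytope P"
    and "self_polar_up_to_scale P"
  shows "int CARD('n) simplex P
    \<and> card X = CARD('n) + 1
    \<and> regular_simplex_vertices X
    \<and> (\<forall>s. spherical_design s X \<longrightarrow> s \<le> 2)
    \<and> \<not> spherical_design 3 X"
proof -
  have poly: "polytope P" and int: "interior P \<noteq> {}" and facets: "bij_betw (support_face P) X {F. F facet_of P}"
    using assms(4) by (auto simp: minkowski_polytope_def)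
  have simplex: "int CARD('n) simplex P"
    by (rule simple_self_polar_simplex[OF assms(1) poly int assms(6,7)])
  \<comment> \<open>\<open>support_face P\<close> matches the points of \<open>X\<close> with the
    facets, of which a d-simplex has d + 1.\<close>
  have card: "card X = CARD('n) + 1"
    using bij_betw_same_card[OF facets] card_facets_simplex[OF simplex] assms(1) by simp
  have not3: "\<not> spherical_design 3 X"
    using design_card_not_3_design[OF card] assms(1) by simp
  then have "s \<le> 2" if "spherical_design s X" for s
    using spherical_design_mono[OF that, of 3] by fastforce
  then show ?thesis
    using simplex card design_regular_simplex[OF assms(3,2) card] not3 by blast
qed

end
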